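(* Let $\varepsilon,q,g$ be real constants with $\varepsilon>0$ and $0<q<g<1$. Consider any combinatorial data structure that, for a string of length $\Theta(n)$ containing $\mathcal{O}(n^g)$ wildcards, answers $\mathrm{LCEW}$ queries in time $\mathcal{O}(n^q)$. Assuming the combinatorial matrix multiplication conjecture, its preprocessing time cannot be $\mathcal{O}(n^{1+g-q-\varepsilon})$.
   Context: $\lozenge$ is a wildcard: $u\sim v$ iff $u=v$ or $u=\lozenge$ or $v=\lozenge$, extended positionwise to equal-length strings. For a string $T$ of length $n$, $\mathrm{LCEW}_T(i,j)=\max\{\ell\le\min(n-i,n-j)+1 : T[i\mathinner{.\,.} i+\ell)\sim T[j\mathinner{.\,.} j+\ell)\}$, where $T[i\mathinner{.\,.} i+\ell)=T[i]\cdots T[i+\ell-1]$. An algorithm or data structure is combinatorial if it does not use fast (algebraic) matrix multiplication as a subroutine during preprocessing or query answering. Combinatorial matrix multiplication conjecture: for every $\varepsilon>0$ and every $\alpha,\beta,\gamma>0$, there is no combinatorial algorithm that computes the product of Boolean matrices of dimensions $n^\alpha\times n^\beta$ and $n^\beta\times n^\gamma$ in time $\mathcal{O}(n^{\alpha+\beta+\gamma-\varepsilon})$. Model: word RAM with word size $\Theta(\log n)$. *)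

theory Defs
  imports Complex_Main
begin

section \<open>Strings with wildcards and LCEW\<close>

text \<open>A string is a list over \<open>nat option\<close>; \<open>None\<close> is the wildcard.\<close>

type_synonym wstring = "nat option list"

definition wmatch :: "nat option \<Rightarrow> nat option \<Rightarrow> bool" where
  "wmatch u v \<longleftrightarrow> u = v \<or> u = None \<or> v = None"

definition wmatches :: "wstring \<Rightarrow> wstring \<Rightarrow> bool" where
  "wmatches = list_all2 wmatch"

text \<open>\<open>substr T i l\<close> is \<open>T[i..i+l)\<close>; positions of a string are numbered from 1.\<close>

definition substr :: "wstring \<Rightarrow> nat \<Rightarrow> nat \<Rightarrow> wstring" where
  "substr T i l = take l (drop (i - 1) T)"

definition lcew :: "wstring \<Rightarrow> nat \<Rightarrow> nat \<Rightarrow> nat" where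
  "lcew T i j = Max {l. l \<le> min (length T - i) (length T - j) + 1 \<and>
                        wmatches (substr T i l) (substr T j l)}"

definition wildcards :: "wstring \<Rightarrow> nat" where
  "wildcards T = length (filter (\<lambda>u. u = None) T)"


section \<open>Word RAM\<close>

text \<open>
  Programs use finitely many registers and finitely many word-addressed arrays (both named by
  natural numbers). All values are words of \<open>w\<close> bits and every basic step costs one unit of time.
  Registers and cells that do not hold the input are initially 0.
\<close>

datatype binop = Add | Sub | Mul | Div | Mod | And | Or | Xor | Shl | Shr

fun binop_val :: "nat \<Rightarrow> binop \<Rightarrow> nat \<Rightarrow> nat \<Rightarrow> nat" where
  "binop_val w Add x y = (x + y) mod 2 ^ w"
| "binop_val w Sub x y = nat ((int x - int y) mod 2 ^ w)"
| "binop_val w Mul x y = (x * y) mod 2 ^ w"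
| "binop_val w Div x y = x div y"
| "binop_val w Mod x y = x mod y"
| "binop_val w And x y = and x y"
| "binop_val w Or x y = or x y"
| "binop_val w Xor x y = xor x y"
| "binop_val w Shl x y = (x * 2 ^ y) mod 2 ^ w"
| "binop_val w Shr x y = x div 2 ^ y"

datatype 'r test = Less 'r 'r | Equal 'r 'r

datatype ('r, 'a) code =
    Skip
  | Const 'r nat
  | Op binop 'r 'r 'r
  | Load 'r 'a 'r
  | Store 'a 'r 'r
  | Seq "('r, 'a) code" "('r, 'a) code" (infixr ";;" 60)
  | If "'r test" "('r, 'a) code" "('r, 'a) code"
  | While "'r test" "('r, 'a) code"

type_synonym program = "(nat, nat) code"

record state =
  reg :: "nat \<Rightarrow> nat"
  arr :: "nat \<Rightarrow> nat \<Rightarrow> nat"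

definition set_reg :: "nat \<Rightarrow> nat \<Rightarrow> state \<Rightarrow> state" where
  "set_reg x v s = s\<lparr>reg := (reg s)(x := v)\<rparr>"

definition set_cell :: "nat \<Rightarrow> nat \<Rightarrow> nat \<Rightarrow> state \<Rightarrow> state" where
  "set_cell a p v s = s\<lparr>arr := (arr s)(a := (arr s a)(p := v))\<rparr>"

fun holds :: "nat test \<Rightarrow> state \<Rightarrow> bool" where
  "holds (Less x y) s \<longleftrightarrow> reg s x < reg s y"
| "holds (Equal x y) s \<longleftrightarrow> reg s x = reg s y"

text \<open>
  \<open>exec w c s t s'\<close>: with word size \<open>w\<close>, program \<open>c\<close> started in \<open>s\<close> halts in \<open>s'\<close> after
  \<open>t\<close> steps.
\<close>

inductive exec :: "nat \<Rightarrow> program \<Rightarrow> state \<Rightarrow> nat \<Rightarrow> state \<Rightarrow> bool" for w :: nat where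
  Skip: "exec w Skip s 1 s"
| Const: "exec w (Const x c) s 1 (set_reg x (c mod 2 ^ w) s)"
| Op: "exec w (Op f x y z) s 1 (set_reg x (binop_val w f (reg s y) (reg s z)) s)"
| Load: "exec w (Load x a y) s 1 (set_reg x (arr s a (reg s y)) s)"
| Store: "exec w (Store a y z) s 1 (set_cell a (reg s y) (reg s z) s)"
| Seq: "exec w c s t s' \<Longrightarrow> exec w d s' t' s'' \<Longrightarrow> exec w (c ;; d) s (t + t') s''"
| IfTrue: "holds b s \<Longrightarrow> exec w c s t s' \<Longrightarrow> exec w (If b c d) s (t + 1) s'"
| IfFalse: "\<not> holds b s \<Longrightarrow> exec w d s t s' \<Longrightarrow> exec w (If b c d) s (t + 1) s'"
| WhileFalse: "\<not> holds b s \<Longrightarrow> exec w (While b c) s 1 s"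
| WhileTrue: "holds b s \<Longrightarrow> exec w c s t s' \<Longrightarrow> exec w (While b c) s' t' s'' \<Longrightarrow>
    exec w (While b c) s (t + t' + 1) s''"

text \<open>
  Word size \<open>\<Theta>(log n)\<close> is rendered in the definitions below as follows: there is a constant
  \<open>\<kappa>\<close> such that, for every constant \<open>\<kappa>'\<close>, the program works for all word sizes between
  \<open>\<kappa> log n\<close> and \<open>\<kappa>' log n\<close>, the constant hidden in the \<open>O\<close> depending on \<open>\<kappa>'\<close>.
  The shift \<open>n + 2\<close> keeps the logarithm positive.
\<close>

definition word_size :: "real \<Rightarrow> real \<Rightarrow> nat \<Rightarrow> nat \<Rightarrow> bool" where
  "word_size \<kappa> \<kappa>' n w \<longleftrightarrow>
     \<kappa> * log 2 (real n + 2) \<le> real w \<and> real w \<le> \<kappa>' * log 2 (real n + 2)"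


section \<open>LCEW data structures\<close>

text \<open>Cell \<open>p\<close> of array 0 holds \<open>T[p+1]\<close> (0 encodes the wildcard) and register 0 the length.\<close>

fun letter_code :: "nat option \<Rightarrow> nat" where
  "letter_code None = 0"
| "letter_code (Some c) = c + 1"

definition string_input :: "wstring \<Rightarrow> state" where
  "string_input T =
     \<lparr>reg = (\<lambda>_. 0)(0 := length T),
      arr = (\<lambda>_ _. 0)(0 := (\<lambda>p. if p < length T then letter_code (T ! p) else 0))\<rparr>"

text \<open>The query \<open>(i, j)\<close> is passed in registers 0 and 1; the answer is returned in register 0.\<close>

definition query_input :: "nat \<Rightarrow> nat \<Rightarrow> state \<Rightarrow> state" where
  "query_input i j s = set_reg 1 j (set_reg 0 i s)"

definition query_position :: "wstring \<Rightarrow> nat \<Rightarrow> bool" where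
  "query_position T i \<longleftrightarrow> 1 \<le> i \<and> i \<le> length T"

text \<open>
  The states that can occur after preprocessing \<open>T\<close> with \<open>P\<close> and answering any number of queries
  with \<open>Q\<close>. Queries are allowed to modify the data structure.
\<close>

inductive ds_state :: "nat \<Rightarrow> program \<Rightarrow> program \<Rightarrow> wstring \<Rightarrow> state \<Rightarrow> bool"
  for w P Q T where
  preprocessed: "exec w P (string_input T) t s \<Longrightarrow> ds_state w P Q T s"
| queried: "ds_state w P Q T s \<Longrightarrow> query_position T i \<Longrightarrow> query_position T j \<Longrightarrow>
    exec w Q (query_input i j s) t s' \<Longrightarrow> ds_state w P Q T s'"

text \<open>
  Strings over the alphabet \<open>{0..<\<sigma>}\<close> of length \<open>\<Theta>(n)\<close> (between \<open>c1 n\<close> and \<open>c2 n\<close>) with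
  \<open>O(n\<^sup>g)\<close> (at most \<open>c3 n\<^sup>g\<close>) wildcards.
\<close>

definition input_class :: "nat \<Rightarrow> real \<Rightarrow> real \<Rightarrow> real \<Rightarrow> real \<Rightarrow> nat \<Rightarrow> wstring set" where
  "input_class \<sigma> c1 c2 c3 g n =
     {T. set T \<subseteq> insert None (Some ` {0..<\<sigma>}) \<and>
         c1 * real n \<le> real (length T) \<and> real (length T) \<le> c2 * real n \<and>
         real (wildcards T) \<le> c3 * real n powr g}"

text \<open>
  \<open>(P, Q)\<close> is a data structure for the strings in the classes \<open>I n\<close> answering LCEW queries in
  worst-case time \<open>O(n\<^sup>q)\<close>.
\<close>

definition lcew_data_structure ::
  "(nat \<Rightarrow> wstring set) \<Rightarrow> real \<Rightarrow> program \<Rightarrow> program \<Rightarrow> bool" where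
  "lcew_data_structure I q P Q \<longleftrightarrow>
     (\<exists>\<kappa>>0. \<forall>\<kappa>'. \<exists>C. \<forall>n\<ge>1. \<forall>w. word_size \<kappa> \<kappa>' n w \<longrightarrow> (\<forall>T\<in>I n.
        (\<exists>t s. exec w P (string_input T) t s) \<and>
        (\<forall>s i j. ds_state w P Q T s \<longrightarrow> query_position T i \<longrightarrow> query_position T j \<longrightarrow>
           (\<exists>t s'. exec w Q (query_input i j s) t s' \<and> real t \<le> C * real n powr q \<and>
                   reg s' 0 = lcew T i j))))"

text \<open>\<open>P\<close> preprocesses the strings in the classes \<open>I n\<close> in time \<open>O(n\<^sup>e)\<close>.\<close>

definition preprocessing_time :: "(nat \<Rightarrow> wstring set) \<Rightarrow> real \<Rightarrow> program \<Rightarrow> bool" where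
  "preprocessing_time I e P \<longleftrightarrow>
     (\<exists>\<kappa>>0. \<forall>\<kappa>'. \<exists>C. \<forall>n\<ge>1. \<forall>w. word_size \<kappa> \<kappa>' n w \<longrightarrow> (\<forall>T\<in>I n.
        \<exists>t s. exec w P (string_input T) t s \<and> real t \<le> C * real n powr e))"


section \<open>Boolean matrix multiplication\<close>

text \<open>Matrices are indexed from 0 and stored in row-major order, one entry per cell.\<close>

type_synonym bmatrix = "nat \<Rightarrow> nat \<Rightarrow> bool"

definition bmm :: "nat \<Rightarrow> bmatrix \<Rightarrow> bmatrix \<Rightarrow> bmatrix" where
  "bmm N2 A B i j \<longleftrightarrow> (\<exists>k<N2. A i k \<and> B k j)"

definition stored :: "nat \<Rightarrow> nat \<Rightarrow> bmatrix \<Rightarrow> nat \<Rightarrow> nat" where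
  "stored rows cols A p = (if p < rows * cols then of_bool (A (p div cols) (p mod cols)) else 0)"

definition matrix_input :: "nat \<Rightarrow> nat \<Rightarrow> nat \<Rightarrow> bmatrix \<Rightarrow> bmatrix \<Rightarrow> state" where
  "matrix_input N1 N2 N3 A B =
     \<lparr>reg = (\<lambda>_. 0)(0 := N1, 1 := N2, 2 := N3),
      arr = (\<lambda>_ _. 0)(0 := stored N1 N2 A, 1 := stored N2 N3 B)\<rparr>"

definition dimension :: "nat \<Rightarrow> real \<Rightarrow> nat" where
  "dimension n \<alpha> = nat \<lfloor>real n powr \<alpha>\<rfloor>"

text \<open>
  \<open>M\<close> multiplies \<open>n\<^sup>\<alpha> \<times> n\<^sup>\<beta>\<close> by \<open>n\<^sup>\<beta> \<times> n\<^sup>\<gamma>\<close> Boolean matrices in time \<open>O(n\<^sup>e)\<close>, leaving the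
  product in array 2.
\<close>

definition multiplies_in_time ::
  "real \<Rightarrow> real \<Rightarrow> real \<Rightarrow> real \<Rightarrow> program \<Rightarrow> bool" where
  "multiplies_in_time \<alpha> \<beta> \<gamma> e M \<longleftrightarrow>
     (\<exists>\<kappa>>0. \<forall>\<kappa>'. \<exists>C. \<forall>n\<ge>1. \<forall>w. word_size \<kappa> \<kappa>' n w \<longrightarrow> (\<forall>A B.
        let N1 = dimension n \<alpha>; N2 = dimension n \<beta>; N3 = dimension n \<gamma> in
        \<exists>t s. exec w M (matrix_input N1 N2 N3 A B) t s \<and> real t \<le> C * real n powr e \<and>
              (\<forall>i<N1. \<forall>j<N3. arr s 2 (i * N3 + j) = of_bool (bmm N2 A B i j))))"


section \<open>Combinatorial algorithms and data structures\<close>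

text \<open>
  ``Does not use fast (algebraic) matrix multiplication as a subroutine'' has no formal definition.
  It is a parameter: an arbitrary property of algorithms and of data structures (preprocessing
  program and query program), of which the theorem uses only the closure property \<open>closed_under_querying\<close>.
\<close>

datatype artefact = Algorithm program | Data_Structure program program

definition combinatorial_mm_conjecture :: "(artefact \<Rightarrow> bool) \<Rightarrow> bool" where
  "combinatorial_mm_conjecture combinatorial \<longleftrightarrow>
     (\<forall>\<epsilon> \<alpha> \<beta> \<gamma>. 0 < \<epsilon> \<longrightarrow> 0 < \<alpha> \<longrightarrow> 0 < \<beta> \<longrightarrow> 0 < \<gamma> \<longrightarrow>
        \<not> (\<exists>M. combinatorial (Algorithm M) \<and>
               multiplies_in_time \<alpha> \<beta> \<gamma> (\<alpha> + \<beta> + \<gamma> - \<epsilon>) M))"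

text \<open>
  The closure property: a loop program that merely copies (relabelled) input entries into the
  input of a combinatorial data structure, has it preprocessed, asks queries and stores one bit per
  answer does not start using fast matrix multiplication. A closure property for arbitrary calling
  programs would make every program combinatorial, so the calling program is explicit. It writes the
  string \<open>rows of A, columns of B, padding\<close>; \<open>K\<close> controls the amount of padding. An entry of
  \<open>A\<close> becomes the wildcard (0) or letter 0 (1), an entry of \<open>B\<close> letter 0 (0) or letter 1 (1).
  Nothing is assumed about what the resulting program computes or how long it runs.
\<close>

definition For :: "nat \<Rightarrow> nat \<Rightarrow> nat \<Rightarrow> program \<Rightarrow> program" where
  "For one x y c = Const x 0 ;; While (Less x y) (c ;; Op Add x x one)"

text \<open>
  The calling program uses registers below 20 and arrays 0, 1, 2. The registers and arrays of the
  data structure are shifted so as to be disjoint from these; in particular its array 0 becomes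
  array 3, and its registers 0 and 1 become 20 and 21.
\<close>

definition relocate :: "program \<Rightarrow> program" where
  "relocate = map_code (\<lambda>r. r + 20) (\<lambda>a. a + 3)"

definition multiply_by_queries :: "nat \<Rightarrow> program \<Rightarrow> program \<Rightarrow> program" where
  "multiply_by_queries K P Q = (
     let N1 = 0; N2 = 1; N3 = 2; one = 3; i = 4; j = 5; k = 6; p = 7; addr = 8; v = 9;
         sizeA = 10; pad = 11; colpos = 12; zero = 13;
         arg0 = 20; arg1 = 21; A = 0; B = 1; C = 2; T = 3
     in
       Const zero 0 ;; Const one 1 ;;
       Op Mul sizeA N1 N2 ;;
       For one p sizeA (Load v A p ;; Store T p v) ;;
       For one j N3 (
         For one k N2 (
           Op Mul addr k N3 ;; Op Add addr addr j ;;
           Load v B addr ;; Op Add v v one ;;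
           Store T p v ;; Op Add p p one)) ;;
       Const pad K ;; Op Mul arg0 p pad ;; Op Add arg0 arg0 pad ;;
       While (Less p arg0) (Store T p one ;; Op Add p p one) ;;
       relocate P ;;
       For one i N1 (
         For one j N3 (
           Op Mul colpos j N2 ;; Op Add colpos colpos sizeA ;; Op Add arg1 colpos one ;;
           Op Mul arg0 i N2 ;; Op Add arg0 arg0 one ;;
           relocate Q ;;
           Op Mul addr i N3 ;; Op Add addr addr j ;;
           If (Less arg0 N2) (Store C addr one) (Store C addr zero))))"

definition closed_under_querying :: "(artefact \<Rightarrow> bool) \<Rightarrow> bool" where
  "closed_under_querying combinatorial \<longleftrightarrow>
     (\<forall>K P Q. combinatorial (Data_Structure P Q) \<longrightarrow>
              combinatorial (Algorithm (multiply_by_queries K P Q)))"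

end

theory Submission
  imports Defs
begin

text \<open>
  Put the rows of \<open>A\<close> and the columns of \<open>B\<close> into one string such that a letter of a row mismatches
  a letter of a column exactly when both entries are 1. The row and the column then have a common 1
  iff the LCEW of their starting positions is smaller than their length, so one query per entry of
  the product suffices. The letters of \<open>A\<close> cost at most \<open>N1 N2\<close> wildcards. With dimensions
  \<open>n\<^sup>\<alpha>\<close>, \<open>n\<^sup>\<beta>\<close>, \<open>n\<^sup>\<gamma>\<close> for \<open>\<alpha> = g - q - \<delta>\<close>, \<open>\<beta> = q + \<delta>\<close>, \<open>\<gamma> = 1 - q - \<delta>\<close> there are at most \<open>n\<^sup>g\<close>
  wildcards and the length is \<open>\<Theta>(n)\<close>. All queries together take time of exponent
  \<open>\<alpha> + \<gamma> + q = 1 + g - q - 2\<delta>\<close>, which beats \<open>\<alpha> + \<beta> + \<gamma> = 1 + g - q - \<delta>\<close> by \<open>\<delta>\<close>; for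
  \<open>2\<delta> \<le> \<epsilon>\<close> so does the assumed preprocessing time, and for \<open>2\<delta> \<le> g - q\<close> so does writing
  the string.
\<close>

section \<open>Reasoning about bounded runs\<close>

text \<open>Total correctness with a step budget; one bounded run is what
  \<open>multiplies_in_time\<close> asks for.\<close>

definition runs :: "nat \<Rightarrow> program \<Rightarrow> nat \<Rightarrow> state \<Rightarrow> (state \<Rightarrow> bool) \<Rightarrow> bool" where
  "runs w c b s \<Phi> \<longleftrightarrow> (\<exists>t s'. exec w c s t s' \<and> t \<le> b \<and> \<Phi> s')"

lemma runsI: "exec w c s t s' \<Longrightarrow> t \<le> b \<Longrightarrow> \<Phi> s' \<Longrightarrow> runs w c b s \<Phi>"
  by (auto simp: runs_def)

lemma runs_mono:
  "runs w c b s \<Phi> \<Longrightarrow> b \<le> b' \<Longrightarrow> (\<And>s'. \<Phi> s' \<Longrightarrow> \<Psi> s') \<Longrightarrow> runs w c b' s \<Psi>"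
  by (fastforce simp: runs_def)

inductive_cases exec_elims [elim!]:
  "exec w (Const x c) s t s'"
  "exec w (Op f x y z) s t s'"
  "exec w (Load x a y) s t s'"
  "exec w (Store a y z) s t s'"
  "exec w (c ;; d) s t s'"

lemma runs_Op [simp]:
  "runs w (Op f x y z) b s \<Phi> \<longleftrightarrow>
     1 \<le> b \<and> \<Phi> (set_reg x (binop_val w f (reg s y) (reg s z)) s)"
  by (auto simp: runs_def intro!: exI exec.Op)

lemma runs_Store [simp]:
  "runs w (Store a y z) b s \<Phi> \<longleftrightarrow> 1 \<le> b \<and> \<Phi> (set_cell a (reg s y) (reg s z) s)"
  by (auto simp: runs_def intro!: exI exec.Store)

lemma runs_Seq:
  "runs w c b s (\<lambda>s'. runs w d b' s' \<Phi>) \<Longrightarrow> runs w (c ;; d) (b + b') s \<Phi>"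
  by (fastforce simp: runs_def intro: exec.Seq)

lemma runs_Seq_then:
  "runs w c b s \<Psi> \<Longrightarrow> (\<And>s'. \<Psi> s' \<Longrightarrow> runs w d b' s' \<Phi>) \<Longrightarrow> runs w (c ;; d) (b + b') s \<Phi>"
  by (rule runs_Seq, erule runs_mono) auto

text \<open>A one-step instruction with a unique outcome is charged to the budget at once. Being an
  equivalence, the rule lets simp execute straight-line code symbolically.\<close>

lemma runs_step:
  assumes "\<And>t s'. exec w c s t s' \<longleftrightarrow> t = 1 \<and> s' = f s"
  shows "runs w (c ;; d) b s \<Phi> \<longleftrightarrow> 1 \<le> b \<and> runs w d (b - 1) (f s) \<Phi>"
proof
  assume "runs w (c ;; d) b s \<Phi>"
  then show "1 \<le> b \<and> runs w d (b - 1) (f s) \<Phi>"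
    using assms by (fastforce simp: runs_def)
next
  assume *: "1 \<le> b \<and> runs w d (b - 1) (f s) \<Phi>"
  then have "runs w (c ;; d) (1 + (b - 1)) s \<Phi>"
    by (intro runs_Seq) (use assms in \<open>auto intro: runsI\<close>)
  with * show "runs w (c ;; d) b s \<Phi>" by simp
qed

lemma runs_Const_Seq [simp]:
  "runs w (Const x c ;; d) b s \<Phi> \<longleftrightarrow> 1 \<le> b \<and> runs w d (b - 1) (set_reg x (c mod 2 ^ w) s) \<Phi>"
  by (rule runs_step) (auto intro: exec.intros[simplified])

lemma runs_Op_Seq [simp]:
  "runs w (Op f x y z ;; d) b s \<Phi> \<longleftrightarrow>
     1 \<le> b \<and> runs w d (b - 1) (set_reg x (binop_val w f (reg s y) (reg s z)) s) \<Phi>"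
  by (rule runs_step) (auto intro: exec.intros[simplified])

lemma runs_Load_Seq [simp]:
  "runs w (Load x a y ;; d) b s \<Phi> \<longleftrightarrow>
     1 \<le> b \<and> runs w d (b - 1) (set_reg x (arr s a (reg s y)) s) \<Phi>"
  by (rule runs_step) (auto intro: exec.intros[simplified])

lemma runs_Store_Seq [simp]:
  "runs w (Store a y z ;; d) b s \<Phi> \<longleftrightarrow>
     1 \<le> b \<and> runs w d (b - 1) (set_cell a (reg s y) (reg s z) s) \<Phi>"
  by (rule runs_step) (auto intro: exec.intros[simplified])

section \<open>Branching and counted loops\<close>

lemma runs_If:
  "runs w (if holds t s then c else d) b s \<Phi> \<Longrightarrow> runs w (If t c d) (Suc b) s \<Phi>"
  by (fastforce simp: runs_def split: if_splits intro: exec.IfTrue exec.IfFalse)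

text \<open>The index \<open>i\<close> is a ghost counter tied to the state by \<open>I\<close>, so
  a loop may start at any \<open>i\<close>. Each round costs the body and one test; the last 1 pays
  for the failing test.\<close>

lemma runs_While:
  assumes "I i s" and "i \<le> n"
    and test: "\<And>i s. I i s \<Longrightarrow> i \<le> n \<Longrightarrow> holds t s \<longleftrightarrow> i < n"
    and body: "\<And>i s. I i s \<Longrightarrow> i < n \<Longrightarrow> runs w c b s (I (Suc i))"
  shows "runs w (While t c) ((n - i) * (b + 1) + 1) s (I n)"
  using assms(1,2)
proof (induction "n - i" arbitrary: i s)
  case 0
  then have "\<not> holds t s" "i = n" using test by auto
  then show ?case using 0 by (auto intro: runsI exec.WhileFalse)
next
  case (Suc d)
  then have i: "i < n" and h: "holds t s" using test by auto
  from body[OF \<open>I i s\<close> i] obtain t1 s1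
    where 1: "exec w c s t1 s1" "t1 \<le> b" "I (Suc i) s1"
    by (auto simp: runs_def)
  have "runs w (While t c) ((n - Suc i) * (b + 1) + 1) s1 (I n)"
    using Suc 1 i by auto
  then obtain t2 s2
    where 2: "exec w (While t c) s1 t2 s2" "t2 \<le> (n - Suc i) * (b + 1) + 1" "I n s2"
    by (auto simp: runs_def)
  have "n - i = Suc (n - Suc i)" using i by simp
  then have "t1 + t2 + 1 \<le> (n - i) * (b + 1) + 1"
    using 1 2 by simp
  then show ?case
    using exec.WhileTrue[OF h 1(1) 2(1)] 2(3) by (auto intro: runsI)
qed

lemma state_simps [simp]:
  "reg (set_reg x v s) = (reg s)(x := v)" "arr (set_reg x v s) = arr s"
  "arr (set_cell a p v s) = (arr s)(a := (arr s a)(p := v))" "reg (set_cell a p v s) = reg s"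
  by (simp_all add: set_reg_def set_cell_def)

text \<open>\<open>n < 2 ^ w\<close> keeps the increment from wrapping around. Each round adds a
  test and an increment to the body; the outer 2 pays for the initialisation and the failing
  test.\<close>

lemma runs_For:
  assumes "I 0 (set_reg x 0 s)" and n: "n < 2 ^ w"
    and regs: "\<And>i s. I i s \<Longrightarrow> reg s x = i \<and> reg s y = n"
    and body: "\<And>i s. I i s \<Longrightarrow> i < n \<Longrightarrow>
      runs w c b s (\<lambda>s'. reg s' x = i \<and> reg s' one = 1 \<and> I (Suc i) (set_reg x (Suc i) s'))"
    and bound: "n * (b + 2) + 2 \<le> b'"
  shows "runs w (For one x y c) b' s (I n)"
proof -
  have "runs w (While (Less x y) (c ;; Op Add x x one)) ((n - 0) * (b + 1 + 1) + 1) (set_reg x 0 s) (I n)"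
  proof (rule runs_While)
    fix i s assume i: "I i s" "i < n"
    show "runs w (c ;; Op Add x x one) (b + 1) s (I (Suc i))"
      by (rule runs_Seq, rule runs_mono[OF body[OF i]]) (use i n in auto)
  qed (use assms in auto)
  then have "runs w (For one x y c) (n * (b + 2) + 2) s (I n)"
    by (simp add: For_def)
  then show ?thesis
    using bound by (rule runs_mono)
qed


section \<open>Relocated programs\<close>

definition outer :: "state \<Rightarrow> state \<Rightarrow> state" where
  "outer S s = \<lparr>reg = (\<lambda>r. if r < 20 then reg S r else reg s (r - 20)),
                arr = (\<lambda>a. if a < 3 then arr S a else arr s (a - 3))\<rparr>"

definition inner :: "state \<Rightarrow> state" where
  "inner S = \<lparr>reg = (\<lambda>r. reg S (r + 20)), arr = (\<lambda>a. arr S (a + 3))\<rparr>"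

lemma outer_inner [simp]: "outer S (inner S) = S"
  by (auto simp: outer_def inner_def fun_eq_iff intro!: state.equality)

lemma inner_outer [simp]: "inner (outer S s) = s"
  by (auto simp: outer_def inner_def fun_eq_iff intro!: state.equality)

lemma outer_simps [simp]:
  "r < 20 \<Longrightarrow> reg (outer S s) r = reg S r" "reg (outer S s) (r + 20) = reg s r"
  "a < 3 \<Longrightarrow> arr (outer S s) a = arr S a" "arr (outer S s) (a + 3) = arr s a"
  by (simp_all add: outer_def)

lemma outer_set_reg: "outer S (set_reg x v s) = set_reg (x + 20) v (outer S s)"
  by (auto simp: outer_def set_reg_def fun_eq_iff)

lemma outer_set_cell: "outer S (set_cell a p v s) = set_cell (a + 3) p v (outer S s)"
  by (auto simp: outer_def set_cell_def fun_eq_iff)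

lemma holds_outer [simp]: "holds (map_test (\<lambda>r. r + 20) b) (outer S s) \<longleftrightarrow> holds b s"
  by (cases b) simp_all

text \<open>Step-for-step simulation: the shifts move every access of \<open>c\<close> outside the
  caller's registers and arrays, so the part taken from \<open>S\<close> never changes and the step
  count is the same.\<close>

lemma exec_relocate:
  "exec w c s t s' \<Longrightarrow> exec w (relocate c) (outer S s) t (outer S s')"
proof (induction rule: exec.induct)
  case (Const x c s)
  show ?case using exec.Const[of w "x + 20" c "outer S s"] by (simp add: relocate_def outer_set_reg)
next
  case (Op f x y z s)
  show ?case using exec.Op[of w f "x + 20" "y + 20" "z + 20" "outer S s"]
    by (simp add: relocate_def outer_set_reg)
next
  case (Load x a y s)
  show ?case using exec.Load[of w "x + 20" "a + 3" "y + 20" "outer S s"]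
    by (simp add: relocate_def outer_set_reg)
next
  case (Store a y z s)
  show ?case using exec.Store[of w "a + 3" "y + 20" "z + 20" "outer S s"]
    by (simp add: relocate_def outer_set_cell)
next
  case (IfTrue b s c t s' d)
  then show ?case by (auto simp: relocate_def intro!: exec.IfTrue[simplified])
next
  case (IfFalse b s d t s' c)
  then show ?case by (auto simp: relocate_def intro!: exec.IfFalse[simplified])
next
  case (WhileTrue b s c t s' t' s'')
  then have "exec w (While (map_test (\<lambda>r. r + 20) b) (relocate c)) (outer S s) (t + t' + 1) (outer S s'')"
    by (intro exec.WhileTrue) (auto simp: relocate_def)
  then show ?case by (simp add: relocate_def)
qed (auto simp: relocate_def intro: exec.intros[simplified])


lemma inner_set_reg [simp]:
  "inner (set_reg x v s) = (if x < 20 then inner s else set_reg (x - 20) v (inner s))"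
  by (auto simp: inner_def set_reg_def fun_eq_iff)

lemma inner_set_cell [simp]:
  "inner (set_cell a p v s) = (if a < 3 then inner s else set_cell (a - 3) p v (inner s))"
  by (auto simp: inner_def set_cell_def fun_eq_iff)

text \<open>Lets \<open>P\<close> and \<open>Q\<close> be treated in their own memory; the caller's
  part of the final state is read off from \<open>S\<close>.\<close>

lemma runs_relocate:
  "runs w c b (inner S) (\<lambda>s'. \<Phi> (outer S s')) \<Longrightarrow> runs w (relocate c) b S \<Phi>"
  unfolding runs_def by (metis exec_relocate outer_inner)


section \<open>The string of two matrices\<close>

text \<open>In the second block \<open>mod\<close> yields the row and \<open>div\<close> the column
  index: \<open>B\<close> is laid out column by column, so that a column is a contiguous
  factor.\<close>

definition letter_at :: "nat \<Rightarrow> nat \<Rightarrow> nat \<Rightarrow> bmatrix \<Rightarrow> bmatrix \<Rightarrow> nat \<Rightarrow> nat option" where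
  "letter_at N1 N2 N3 A B p =
     (if p < N1 * N2 then if A (p div N2) (p mod N2) then Some 0 else None
      else if p < N1 * N2 + N2 * N3 then
        Some (of_bool (B ((p - N1 * N2) mod N2) ((p - N1 * N2) div N2)))
      else Some 0)"

definition matrix_string :: "nat \<Rightarrow> nat \<Rightarrow> nat \<Rightarrow> nat \<Rightarrow> bmatrix \<Rightarrow> bmatrix \<Rightarrow> wstring" where
  "matrix_string L N1 N2 N3 A B = map (letter_at N1 N2 N3 A B) [0..<L]"

lemma length_matrix_string [simp]: "length (matrix_string L N1 N2 N3 A B) = L"
  by (simp add: matrix_string_def)

lemma nth_matrix_string [simp]:
  "p < L \<Longrightarrow> matrix_string L N1 N2 N3 A B ! p = letter_at N1 N2 N3 A B p"
  by (simp add: matrix_string_def)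

lemma set_matrix_string:
  "2 \<le> \<sigma> \<Longrightarrow> set (matrix_string L N1 N2 N3 A B) \<subseteq> insert None (Some ` {0..<\<sigma>})"
  by (auto simp: matrix_string_def letter_at_def)

text \<open>Only zeros of \<open>A\<close> become wildcards; in particular the padding adds none,
  however large \<open>L\<close> is.\<close>

lemma wildcards_matrix_string: "wildcards (matrix_string L N1 N2 N3 A B) \<le> N1 * N2"
proof -
  have "wildcards (matrix_string L N1 N2 N3 A B) =
      card {p. p < L \<and> letter_at N1 N2 N3 A B p = None}"
    by (simp add: wildcards_def length_filter_conv_card cong: conj_cong)
  also have "\<dots> \<le> card {..<N1 * N2}"
    by (rule card_mono) (auto simp: letter_at_def split: if_splits)
  finally show ?thesis by simp
qed

section \<open>LCEW values as tests for a common 1\<close>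

lemma wmatches_substr_iff:
  assumes "a + l \<le> length T" "b + l \<le> length T"
  shows "wmatches (substr T (a + 1) l) (substr T (b + 1) l) \<longleftrightarrow>
    (\<forall>k<l. wmatch (T ! (a + k)) (T ! (b + k)))"
  using assms by (auto simp: wmatches_def substr_def list_all2_conv_all_nth)

text \<open>A prefix of a match is a match, so the admissible lengths are closed downwards and the
  maximum reaches \<open>l\<close> iff \<open>l\<close> itself is admissible. The indices
  \<open>a\<close> and \<open>b\<close> count from 0; since they are below \<open>length T\<close>,
  the truncated subtraction plus 1 loses nothing.\<close>

lemma lcew_ge_iff:
  assumes "a + l \<le> length T" "b + l \<le> length T" "a < length T" "b < length T"
  shows "l \<le> lcew T (a + 1) (b + 1) \<longleftrightarrow> (\<forall>k<l. wmatch (T ! (a + k)) (T ! (b + k)))"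
proof -
  let ?S = "{l. l \<le> min (length T - (a + 1)) (length T - (b + 1)) + 1 \<and>
                 wmatches (substr T (a + 1) l) (substr T (b + 1) l)}"
  have S: "?S = {l. a + l \<le> length T \<and> b + l \<le> length T \<and>
      (\<forall>k<l. wmatch (T ! (a + k)) (T ! (b + k)))}"
    using assms(3,4) by (auto simp: wmatches_substr_iff[of a _ T b, simplified])
  have fin: "finite ?S" unfolding S by (rule finite_subset[of _ "{..length T}"]) auto
  \<comment> \<open>The empty match makes \<open>?S\<close> nonempty, as \<open>Max\<close>
    requires.\<close>
  have "0 \<in> ?S" by (simp add: substr_def wmatches_def)
  then have mem: "Max ?S \<in> ?S" using fin by (intro Max_in) auto
  show ?thesis unfolding lcew_def
  proof
    assume "l \<le> Max ?S"
    then show "\<forall>k<l. wmatch (T ! (a + k)) (T ! (b + k))" using mem unfolding S by auto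
  next
    assume "\<forall>k<l. wmatch (T ! (a + k)) (T ! (b + k))"
    then have "l \<in> ?S" using assms unfolding S by simp
    then show "l \<le> Max ?S" using fin by (rule Max_ge[rotated])
  qed
qed

lemma row_major_less:
  fixes i j m n :: nat
  assumes "i < m" "j < n" shows "i * n + j < m * n"
proof -
  have "i * n + j < Suc i * n" using assms by simp
  also have "\<dots> \<le> m * n" using assms by (intro mult_le_mono1) simp
  finally show ?thesis .
qed

text \<open>Row \<open>i\<close> and column \<open>j\<close> are blocks of \<open>N2\<close> letters
  that mismatch at offset \<open>k\<close> exactly when \<open>A i k\<close> and
  \<open>B k j\<close> both hold. Only the threshold \<open>N2\<close> is tested, so the letters
  after the blocks do not matter.\<close>

lemma lcew_matrix_string:
  assumes "N1 * N2 + N2 * N3 \<le> L" "i < N1" "j < N3" "0 < N2"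
  shows "lcew (matrix_string L N1 N2 N3 A B) (i * N2 + 1) (j * N2 + N1 * N2 + 1) < N2
    \<longleftrightarrow> bmm N2 A B i j"
proof -
  have a: "i * N2 + k < N1 * N2" if "k < N2" for k
    using row_major_less assms that by blast
  have b: "j * N2 + k < N2 * N3" if "k < N2" for k
    using row_major_less[of j N3 k N2] assms that by (simp add: mult.commute)
  let ?T = "matrix_string L N1 N2 N3 A B"
  have "N2 \<le> lcew ?T (i * N2 + 1) (j * N2 + N1 * N2 + 1) \<longleftrightarrow>
      (\<forall>k<N2. wmatch (?T ! (i * N2 + k)) (?T ! (j * N2 + N1 * N2 + k)))"
    \<comment> \<open>The bounds at the last offset place both blocks inside
      \<open>?T\<close>.\<close>
    using a[of "N2 - 1"] b[of "N2 - 1"] assms by (intro lcew_ge_iff) auto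
  also have "\<dots> \<longleftrightarrow> (\<forall>k<N2. \<not> (A i k \<and> B k j))"
  proof (intro all_cong imp_cong refl)
    fix k assume k: "k < N2"
    have "?T ! (i * N2 + k) = (if A i k then Some 0 else None)"
      using a[OF k] assms k by (simp add: letter_at_def)
    moreover have "?T ! (j * N2 + N1 * N2 + k) = Some (of_bool (B k j))"
      using b[OF k] assms k by (simp add: letter_at_def)
    ultimately show "wmatch (?T ! (i * N2 + k)) (?T ! (j * N2 + N1 * N2 + k)) \<longleftrightarrow> \<not> (A i k \<and> B k j)"
      by (auto simp: wmatch_def)
  qed
  finally show ?thesis by (auto simp: bmm_def not_le[symmetric])
qed

section \<open>Correctness of the calling program\<close>

text \<open>
  The program fragments below are those of \<open>multiply_by_queries\<close> with its register and array names
  replaced by numbers.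
\<close>

definition frame :: "nat \<Rightarrow> nat \<Rightarrow> nat \<Rightarrow> state \<Rightarrow> bool" where
  "frame N1 N2 N3 s \<longleftrightarrow> reg s 0 = N1 \<and> reg s 1 = N2 \<and> reg s 2 = N3 \<and> reg s 3 = 1 \<and>
     reg s 10 = N1 * N2 \<and> reg s 13 = 0"

text \<open>The data structure's memory after \<open>p\<close> letters. All the rest is still 0, as
  \<open>string_input\<close> demands of the state in which \<open>P\<close> starts.\<close>

definition loaded :: "nat \<Rightarrow> nat \<Rightarrow> nat \<Rightarrow> bmatrix \<Rightarrow> bmatrix \<Rightarrow> nat \<Rightarrow> state" where
  "loaded N1 N2 N3 A B p = \<lparr>reg = \<lambda>_. 0,
     arr = (\<lambda>_ _. 0)(0 := (\<lambda>x. if x < p then letter_code (letter_at N1 N2 N3 A B x) else 0))\<rparr>"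

definition loading :: "nat \<Rightarrow> nat \<Rightarrow> nat \<Rightarrow> bmatrix \<Rightarrow> bmatrix \<Rightarrow> nat \<Rightarrow> state \<Rightarrow> bool" where
  "loading N1 N2 N3 A B p s \<longleftrightarrow> frame N1 N2 N3 s \<and> reg s 7 = p \<and>
     arr s 0 = stored N1 N2 A \<and> arr s 1 = stored N2 N3 B \<and> inner s = loaded N1 N2 N3 A B p"

lemma store_loaded:
  "v = letter_code (letter_at N1 N2 N3 A B p) \<Longrightarrow>
     set_cell 0 p v (loaded N1 N2 N3 A B p) = loaded N1 N2 N3 A B (Suc p)"
  by (auto simp: loaded_def set_cell_def fun_eq_iff less_Suc_eq)

text \<open>Only the length is missing after the last letter. The caller's register 20, which bounds
  the padding loop, is register 0 of the data structure, so computing that bound supplies the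
  length.\<close>

lemma loaded_eq_string_input:
  "set_reg 0 L (loaded N1 N2 N3 A B L) = string_input (matrix_string L N1 N2 N3 A B)"
  by (auto simp: loaded_def set_reg_def string_input_def fun_eq_iff)

text \<open>Entries and codes coincide (0 is the wildcard, 1 is letter 0), so the rows are copied
  unchanged.\<close>

lemma letter_at_row:
  "p < N1 * N2 \<Longrightarrow> letter_code (letter_at N1 N2 N3 A B p) = stored N1 N2 A p"
  by (simp add: letter_at_def stored_def)

lemma letter_at_column:
  assumes "j < N3" "k < N2"
  shows "letter_code (letter_at N1 N2 N3 A B (N1 * N2 + j * N2 + k)) = stored N2 N3 B (k * N3 + j) + 1"
proof -
  have "j * N2 + k < N2 * N3" "k * N3 + j < N2 * N3"
    using row_major_less[of j N3 k N2] row_major_less[of k N2 j N3] assms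
    by (simp_all add: mult.commute)
  then show ?thesis using assms by (simp add: letter_at_def stored_def)
qed

lemma runs_load_rows:
  assumes "loading N1 N2 N3 A B 0 (set_reg 7 0 s)" and "N1 * N2 < 2 ^ w"
  shows "runs w (For 3 7 10 (Load 9 0 7 ;; Store 3 7 9)) (N1 * N2 * 4 + 2) s
    (loading N1 N2 N3 A B (N1 * N2))"
  by (rule runs_For[where b = 2])
     (use assms in \<open>auto simp: loading_def frame_def store_loaded letter_at_row\<close>)

lemma runs_load_column:
  assumes "loading N1 N2 N3 A B (N1 * N2 + j * N2) s" "reg s 5 = j" "j < N3"
    and w: "N1 * N2 + N2 * N3 < 2 ^ w" "2 < (2::nat) ^ w" "N2 < 2 ^ w"
  shows "runs w (For 3 6 1 (Op Mul 8 6 2 ;; Op Add 8 8 5 ;; Load 9 1 8 ;; Op Add 9 9 3 ;;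
      Store 3 7 9 ;; Op Add 7 7 3)) (N2 * 8 + 2) s
    (\<lambda>s'. loading N1 N2 N3 A B (N1 * N2 + j * N2 + N2) s' \<and> reg s' 5 = j \<and> reg s' 6 = N2)"
proof (rule runs_For[where b = 6 and
      I = "\<lambda>k s. loading N1 N2 N3 A B (N1 * N2 + j * N2 + k) s \<and> reg s 5 = j \<and> reg s 6 = k"])
  fix k s
  assume s: "loading N1 N2 N3 A B (N1 * N2 + j * N2 + k) s \<and> reg s 5 = j \<and> reg s 6 = k"
    and k: "k < N2"
  \<comment> \<open>The target offset in the column block and the source index in \<open>B\<close>
    are both below \<open>N2 * N3\<close>, so no address overflows.\<close>
  have "j * N2 + k < N2 * N3" "k * N3 + j < N2 * N3"
    using row_major_less[of j N3 k N2] row_major_less[of k N2 j N3] k \<open>j < N3\<close>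
    by (simp_all add: mult.commute)
  moreover have "stored N2 N3 B (k * N3 + j) \<le> 1" by (simp add: stored_def)
  ultimately show "runs w (Op Mul 8 6 2 ;; Op Add 8 8 5 ;; Load 9 1 8 ;; Op Add 9 9 3 ;;
      Store 3 7 9 ;; Op Add 7 7 3) 6 s
    (\<lambda>s'. reg s' 6 = k \<and> reg s' 3 = 1 \<and>
      loading N1 N2 N3 A B (N1 * N2 + j * N2 + Suc k) (set_reg 6 (Suc k) s') \<and>
      reg (set_reg 6 (Suc k) s') 5 = j \<and> reg (set_reg 6 (Suc k) s') 6 = Suc k)"
    using s k w \<open>j < N3\<close>
    by (auto simp: loading_def frame_def store_loaded letter_at_column)
qed (use assms in \<open>auto simp: loading_def frame_def\<close>)

lemma runs_load_columns:
  assumes "loading N1 N2 N3 A B (N1 * N2) s"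
    and w: "N1 * N2 + N2 * N3 < 2 ^ w" "2 < (2::nat) ^ w" "N2 < 2 ^ w" "N3 < 2 ^ w"
  shows "runs w (For 3 5 2 (For 3 6 1 (Op Mul 8 6 2 ;; Op Add 8 8 5 ;; Load 9 1 8 ;;
      Op Add 9 9 3 ;; Store 3 7 9 ;; Op Add 7 7 3))) (N3 * (N2 * 8 + 2 + 2) + 2) s
    (\<lambda>s'. loading N1 N2 N3 A B (N1 * N2 + N3 * N2) s' \<and> reg s' 5 = N3)"
proof (rule runs_For[where b = "N2 * 8 + 2" and
      I = "\<lambda>j s. loading N1 N2 N3 A B (N1 * N2 + j * N2) s \<and> reg s 5 = j"])
  fix j s
  assume s: "loading N1 N2 N3 A B (N1 * N2 + j * N2) s \<and> reg s 5 = j" and j: "j < N3"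
  show "runs w (For 3 6 1 (Op Mul 8 6 2 ;; Op Add 8 8 5 ;; Load 9 1 8 ;;
      Op Add 9 9 3 ;; Store 3 7 9 ;; Op Add 7 7 3)) (N2 * 8 + 2) s
    (\<lambda>s'. reg s' 5 = j \<and> reg s' 3 = 1 \<and>
      loading N1 N2 N3 A B (N1 * N2 + Suc j * N2) (set_reg 5 (Suc j) s') \<and>
      reg (set_reg 5 (Suc j) s') 5 = Suc j)"
    by (rule runs_mono[OF runs_load_column[of N1 N2 N3 A B j]])
       (use s j w in \<open>auto simp: loading_def frame_def algebra_simps\<close>)
qed (use assms in \<open>auto simp: loading_def frame_def\<close>)

lemma runs_pad:
  assumes "frame N1 N2 N3 s" "reg s 7 = p" "inner s = set_reg 0 L (loaded N1 N2 N3 A B p)"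
    and "N1 * N2 + N2 * N3 \<le> p" "p \<le> L" and w: "L < 2 ^ w"
  shows "runs w (While (Less 7 20) (Store 3 7 3 ;; Op Add 7 7 3)) (3 * L + 1) s
    (\<lambda>s'. frame N1 N2 N3 s' \<and> inner s' = string_input (matrix_string L N1 N2 N3 A B))"
proof -
  \<comment> \<open>The lower bound on \<open>i\<close> keeps \<open>letter_at\<close> in its
    padding case; the code of letter 0 is 1, the content of register 3.\<close>
  define I where "I = (\<lambda>i s. N1 * N2 + N2 * N3 \<le> i \<and> frame N1 N2 N3 s \<and> reg s 7 = i \<and>
    inner s = set_reg 0 L (loaded N1 N2 N3 A B i))"
  have reg_20: "reg s 20 = reg (inner s) 0" for s by (simp add: inner_def)
  have swap: "set_cell 0 i v (set_reg 0 L s) = set_reg 0 L (set_cell 0 i v s)" for i v s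
    by (simp add: set_cell_def set_reg_def)
  have "runs w (While (Less 7 20) (Store 3 7 3 ;; Op Add 7 7 3)) ((L - p) * (2 + 1) + 1) s (I L)"
  proof (rule runs_While)
    fix i s assume "I i s" "i < L"
    then show "runs w (Store 3 7 3 ;; Op Add 7 7 3) 2 s (I (Suc i))"
      using w by (auto simp: I_def frame_def swap store_loaded letter_at_def)
  qed (use assms in \<open>auto simp: I_def reg_20\<close>)
  then show ?thesis
    by (rule runs_mono) (auto simp: I_def loaded_eq_string_input)
qed

section \<open>Queries and the entries of the product\<close>

definition answered :: "nat \<Rightarrow> nat \<Rightarrow> bmatrix \<Rightarrow> bmatrix \<Rightarrow> nat \<Rightarrow> state \<Rightarrow> bool" where
  "answered N2 N3 A B n s \<longleftrightarrow> (\<forall>x<n. arr s 2 x = of_bool (bmm N2 A B (x div N3) (x mod N3)))"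

text \<open>A query may alter the data structure, so the invariant is the reachability predicate
  \<open>ds_state\<close> rather than a fixed memory. The 9 counts seven operations, one test and
  one store.\<close>

lemma runs_query:
  fixes N1 N2 N3 L :: nat and A B :: bmatrix
  defines "T \<equiv> matrix_string L N1 N2 N3 A B"
  assumes L: "N1 * N2 + N2 * N3 \<le> L" "L < 2 ^ w" "N1 * N3 < 2 ^ w" and "0 < N2"
    and query: "\<And>s i j. ds_state w P Q T s \<Longrightarrow> query_position T i \<Longrightarrow> query_position T j \<Longrightarrow>
      runs w Q tQ (query_input i j s) (\<lambda>s'. reg s' 0 = lcew T i j)"
    and s: "frame N1 N2 N3 s" "ds_state w P Q T (inner s)" "answered N2 N3 A B (i * N3 + j) s"
    and regs: "reg s 4 = i" "reg s 5 = j" and "i < N1" "j < N3"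
  shows "runs w (Op Mul 12 5 1 ;; Op Add 12 12 10 ;; Op Add 21 12 3 ;;
      Op Mul 20 4 1 ;; Op Add 20 20 3 ;; relocate Q ;;
      Op Mul 8 4 2 ;; Op Add 8 8 5 ;; If (Less 20 1) (Store 2 8 3) (Store 2 8 13)) (tQ + 9) s
    (\<lambda>s'. frame N1 N2 N3 s' \<and> ds_state w P Q T (inner s') \<and>
      answered N2 N3 A B (Suc (i * N3 + j)) s' \<and> reg s' 4 = i \<and> reg s' 5 = j)"
proof -
  let ?a = "i * N2 + 1" and ?b = "j * N2 + N1 * N2 + 1"
  have a: "i * N2 + 1 \<le> N1 * N2"
    using row_major_less[of i N1 0 N2] \<open>i < N1\<close> \<open>0 < N2\<close> by linarith
  have b: "j * N2 + 1 \<le> N2 * N3"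
    using row_major_less[of j N3 0 N2] \<open>j < N3\<close> \<open>0 < N2\<close>
    unfolding mult.commute[of N2 N3] by linarith
  have c: "i * N3 + j < N1 * N3"
    using row_major_less assms by blast
  have ab: "query_position T ?a" "query_position T ?b"
    using a b L by (auto simp: query_position_def T_def)
  have small: "j * N2 < 2 ^ w" "i * N2 < 2 ^ w" "j * N2 + N1 * N2 < 2 ^ w"
      "?a < 2 ^ w" "?b < 2 ^ w" "i * N3 < 2 ^ w" "i * N3 + j < 2 ^ w"
    using a b c L by linarith+
  \<comment> \<open>The state at the call, with overwritten intermediate values kept so that it has
    the form simp obtains from the five operations.\<close>
  define s1 where "s1 = set_reg 20 ?a (set_reg 20 (i * N2) (set_reg 21 ?b
    (set_reg 12 (j * N2 + N1 * N2) (set_reg 12 (j * N2) s))))"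
  have "set_reg 0 ?a (set_reg 0 (i * N2) (set_reg 1 ?b (inner s))) = query_input ?a ?b (inner s)"
    by (auto simp: query_input_def set_reg_def fun_eq_iff)
  then have in1: "inner s1 = query_input ?a ?b (inner s)"
    by (simp add: s1_def)
  have "runs w Q tQ (inner s1) (\<lambda>s'. reg s' 0 = lcew T ?a ?b \<and> ds_state w P Q T s')"
    using query[OF s(2) ab] ds_state.queried[OF s(2) ab] by (auto simp: runs_def in1)
  then have "runs w (relocate Q) tQ s1 (\<lambda>s'. frame N1 N2 N3 s' \<and> ds_state w P Q T (inner s') \<and>
      answered N2 N3 A B (i * N3 + j) s' \<and> reg s' 4 = i \<and> reg s' 5 = j \<and> reg s' 20 = lcew T ?a ?b)"
    by (intro runs_relocate, elim runs_mono)
       (use s regs in \<open>auto simp: outer_simps(2)[of _ _ 0, simplified] s1_def frame_def answered_def\<close>)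
  then have "runs w (relocate Q ;; (Op Mul 8 4 2 ;; Op Add 8 8 5 ;;
      If (Less 20 1) (Store 2 8 3) (Store 2 8 13))) (tQ + 4) s1
    (\<lambda>s'. frame N1 N2 N3 s' \<and> ds_state w P Q T (inner s') \<and>
      answered N2 N3 A B (Suc (i * N3 + j)) s' \<and> reg s' 4 = i \<and> reg s' 5 = j)"
  proof (intro runs_Seq, elim runs_mono, goal_cases)
    case (2 s')
    have "lcew T ?a ?b < N2 \<longleftrightarrow> bmm N2 A B i j"
      using lcew_matrix_string L assms by (simp add: T_def)
    then have "runs w (If (Less 20 1) (Store 2 8 3) (Store 2 8 13)) (Suc 1)
      (set_reg 8 (i * N3 + j) (set_reg 8 (i * N3) s'))
      (\<lambda>s'. frame N1 N2 N3 s' \<and> ds_state w P Q T (inner s') \<and>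
        answered N2 N3 A B (Suc (i * N3 + j)) s' \<and> reg s' 4 = i \<and> reg s' 5 = j)"
      using 2 \<open>j < N3\<close>
      by (intro runs_If) (auto simp: frame_def answered_def less_Suc_eq)
    then show ?case using 2 small by (auto simp: frame_def numeral_2_eq_2)
  qed simp
  then show ?thesis
    using s regs small by (simp add: frame_def s1_def add.commute)
qed

lemma runs_queries:
  fixes N1 N2 N3 L :: nat and A B :: bmatrix
  defines "T \<equiv> matrix_string L N1 N2 N3 A B"
  assumes L: "N1 * N2 + N2 * N3 \<le> L" "L < 2 ^ w" "N1 * N3 < 2 ^ w"
    and N: "0 < N2" "N1 < 2 ^ w" "N3 < 2 ^ w"
    and query: "\<And>s i j. ds_state w P Q T s \<Longrightarrow> query_position T i \<Longrightarrow> query_position T j \<Longrightarrow>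
      runs w Q tQ (query_input i j s) (\<lambda>s'. reg s' 0 = lcew T i j)"
    and s: "frame N1 N2 N3 s" "ds_state w P Q T (inner s)"
  shows "runs w (For 3 4 0 (For 3 5 2 (Op Mul 12 5 1 ;; Op Add 12 12 10 ;; Op Add 21 12 3 ;;
      Op Mul 20 4 1 ;; Op Add 20 20 3 ;; relocate Q ;;
      Op Mul 8 4 2 ;; Op Add 8 8 5 ;; If (Less 20 1) (Store 2 8 3) (Store 2 8 13))))
    (N1 * (N3 * (tQ + 11) + 2 + 2) + 2) s (\<lambda>s'. answered N2 N3 A B (N1 * N3) s')"
proof -
  define I where "I = (\<lambda>i s. frame N1 N2 N3 s \<and> ds_state w P Q T (inner s) \<and>
      answered N2 N3 A B (i * N3) s \<and> reg s 4 = i)"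
  \<comment> \<open>At \<open>j = N3\<close> the count \<open>i * N3 + j\<close> is
    \<open>Suc i * N3\<close>, so the end of the inner loop yields \<open>I\<close> for the next
    row.\<close>
  define J where "J = (\<lambda>i j s. frame N1 N2 N3 s \<and> ds_state w P Q T (inner s) \<and>
      answered N2 N3 A B (i * N3 + j) s \<and> reg s 4 = i \<and> reg s 5 = j)"
  define body :: program where "body = (Op Mul 12 5 1 ;; Op Add 12 12 10 ;; Op Add 21 12 3 ;;
      Op Mul 20 4 1 ;; Op Add 20 20 3 ;; relocate Q ;;
      Op Mul 8 4 2 ;; Op Add 8 8 5 ;; If (Less 20 1) (Store 2 8 3) (Store 2 8 13))"
  have body: "runs w body (tQ + 9) s
      (\<lambda>s'. reg s' 5 = j \<and> reg s' 3 = 1 \<and> J i (Suc j) (set_reg 5 (Suc j) s'))"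
    if "J i j s" "i < N1" "j < N3" for i j s
    unfolding body_def
  proof (rule runs_mono[OF runs_query[where P = P and L = L and A = A and B = B and i = i and j = j]])
    show "runs w Q tQ (query_input i' j' s') (\<lambda>s''. reg s'' 0 = lcew (matrix_string L N1 N2 N3 A B) i' j')"
      if "ds_state w P Q (matrix_string L N1 N2 N3 A B) s'"
        "query_position (matrix_string L N1 N2 N3 A B) i'"
        "query_position (matrix_string L N1 N2 N3 A B) j'" for i' j' s'
      using query that by (simp add: T_def)
  qed (use that L N in \<open>auto simp: J_def T_def frame_def answered_def\<close>)
  have inner_loop: "runs w (For 3 5 2 body) (N3 * (tQ + 11) + 2) s (J i N3)"
    if "I i s" "i < N1" for i s
  proof (rule runs_For[where b = "tQ + 9" and I = "J i"])
    show "runs w body (tQ + 9) s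
      (\<lambda>s'. reg s' 5 = j \<and> reg s' 3 = 1 \<and> J i (Suc j) (set_reg 5 (Suc j) s'))"
      if "J i j s" "j < N3" for j s
      using body that \<open>i < N1\<close> by blast
  qed (use that N in \<open>auto simp: I_def J_def frame_def answered_def\<close>)
  have "runs w (For 3 4 0 (For 3 5 2 body)) (N1 * (N3 * (tQ + 11) + 2 + 2) + 2) s (I N1)"
  proof (rule runs_For[where b = "N3 * (tQ + 11) + 2" and I = I])
    fix i s assume i: "I i s" "i < N1"
    show "runs w (For 3 5 2 body) (N3 * (tQ + 11) + 2) s
      (\<lambda>s'. reg s' 4 = i \<and> reg s' 3 = 1 \<and> I (Suc i) (set_reg 4 (Suc i) s'))"
      by (rule runs_mono[OF inner_loop[OF i]])
        (auto simp: I_def J_def frame_def answered_def add.commute)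
  qed (use s N in \<open>auto simp: I_def frame_def answered_def\<close>)
  then show ?thesis
    unfolding body_def by (rule runs_mono) (auto simp: I_def)
qed

text \<open>The costs are writing the string, preprocessing it once, and one query per entry. The
  constants 30 and 15 leave slack for all loop overheads.\<close>

lemma runs_multiply_by_queries:
  fixes K N1 N2 N3 :: nat and A B :: bmatrix
  defines "L \<equiv> K * (N1 * N2 + N2 * N3 + 1)"
  defines "T \<equiv> matrix_string L N1 N2 N3 A B"
  assumes N: "0 < N1" "0 < N2" "0 < N3" "0 < K" and L: "L < 2 ^ w" "N1 * N3 < 2 ^ w"
    and pre: "runs w P tP (string_input T) (\<lambda>_. True)"
    and query: "\<And>s i j. ds_state w P Q T s \<Longrightarrow> query_position T i \<Longrightarrow> query_position T j \<Longrightarrow>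
      runs w Q tQ (query_input i j s) (\<lambda>s'. reg s' 0 = lcew T i j)"
  shows "runs w (multiply_by_queries K P Q) (30 * L + tP + N1 * N3 * (tQ + 15))
    (matrix_input N1 N2 N3 A B)
    (\<lambda>s. \<forall>i<N1. \<forall>j<N3. arr s 2 (i * N3 + j) = of_bool (bmm N2 A B i j))"
proof -
  have N1: "N1 \<le> N1 * N2" and N3: "N3 \<le> N2 * N3" and N2: "N2 \<le> N2 * N3" "1 \<le> N1 * N2"
    using N by auto
  have "1 * (N1 * N2 + N2 * N3 + 1) \<le> L"
    unfolding L_def using N by (intro mult_le_mono1) simp
  then have sum_L: "N1 * N2 + N2 * N3 + 1 \<le> L" by simp
  have K: "K \<le> L" by (simp add: L_def)
  \<comment> \<open>\<open>sum_L\<close> forces \<open>L\<close> to be at least 3, so that the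
    largest letter code 2 fits into a word.\<close>
  have small: "N1 < 2 ^ w" "N2 < 2 ^ w" "N3 < 2 ^ w" "N1 * N2 < 2 ^ w" "N1 * N2 + N2 * N3 < 2 ^ w"
      "2 < (2 :: nat) ^ w" "K < 2 ^ w"
    using N1 N2 N3 sum_L K L N by linarith+
  have pad: "(N1 * N2 + N2 * N3) * K + K = L" by (simp add: L_def algebra_simps)
  then have small': "(N1 * N2 + N2 * N3) * K < 2 ^ w" using L by linarith
  define post where "post = (\<lambda>s :: state. \<forall>i<N1. \<forall>j<N3. arr s 2 (i * N3 + j) = of_bool (bmm N2 A B i j))"
  define tq where "tq = N1 * (N3 * (tQ + 11) + 2 + 2) + 2"
  define t2 where "t2 = 3 * L + 1 + (tP + tq)"
  define t1 where "t1 = N1 * N2 * 4 + 2 + (N3 * (N2 * 8 + 2 + 2) + 2 + (3 + t2))"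
  let ?p = "N1 * N2 + N2 * N3"
  define query_part :: program where "query_part = For 3 4 0 (For 3 5 2 (
      Op Mul 12 5 1 ;; Op Add 12 12 10 ;; Op Add 21 12 3 ;;
      Op Mul 20 4 1 ;; Op Add 20 20 3 ;; relocate Q ;;
      Op Mul 8 4 2 ;; Op Add 8 8 5 ;; If (Less 20 1) (Store 2 8 3) (Store 2 8 13)))"
  \<comment> \<open>Facts 5 down to 2 treat the program from its last phase backwards, each ending
    in \<open>post\<close>.\<close>
  have 5: "runs w query_part tq s post"
    if "frame N1 N2 N3 s \<and> ds_state w P Q T (inner s)" for s
    unfolding query_part_def tq_def
  proof (rule runs_mono[OF runs_queries[of N1 N2 N3 L w P Q A B tQ s]])
    fix s' i j
    show "answered N2 N3 A B (N1 * N3) s' \<Longrightarrow> post s'"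
      using row_major_less by (auto simp: answered_def post_def)
  qed (use that N small L sum_L query in \<open>auto simp: T_def\<close>)
  have 4: "runs w (relocate P ;; query_part) (tP + tq) s post"
    if s: "frame N1 N2 N3 s" "inner s = string_input T" for s
  proof (rule runs_Seq_then[OF _ 5])
    have "runs w P tP (inner s) (ds_state w P Q T)"
      using pre s by (auto simp: runs_def intro: ds_state.preprocessed)
    then show "runs w (relocate P) tP s (\<lambda>s. frame N1 N2 N3 s \<and> ds_state w P Q T (inner s))"
      by (intro runs_relocate, elim runs_mono) (use s in \<open>auto simp: frame_def\<close>)
  qed
  have 3: "runs w (Const 11 K ;; Op Mul 20 7 11 ;; Op Add 20 20 11 ;;
      While (Less 7 20) (Store 3 7 3 ;; Op Add 7 7 3) ;; relocate P ;; query_part)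
      (3 + t2) s post"
    if s: "loading N1 N2 N3 A B ?p s" for s
  proof -
    let ?s = "set_reg 20 L (set_reg 20 (?p * K) (set_reg 11 K s))"
    have "set_reg 0 L (set_reg 0 (?p * K) (inner s)) = set_reg 0 L (inner s)"
      by (simp add: set_reg_def)
    then have "runs w (While (Less 7 20) (Store 3 7 3 ;; Op Add 7 7 3)) (3 * L + 1) ?s
      (\<lambda>s'. frame N1 N2 N3 s' \<and> inner s' = string_input (matrix_string L N1 N2 N3 A B))"
      using s sum_L L by (intro runs_pad[of _ _ _ _ ?p]) (auto simp: loading_def frame_def)
    then have "runs w (While (Less 7 20) (Store 3 7 3 ;; Op Add 7 7 3) ;; relocate P ;; query_part)
      t2 ?s post"
      unfolding t2_def by (rule runs_Seq_then) (use 4 in \<open>auto simp: T_def\<close>)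
    then show ?thesis
      using s small small' L pad by (simp add: loading_def)
  qed
  have "runs w (multiply_by_queries K P Q) (3 + t1) (matrix_input N1 N2 N3 A B) post"
  proof -
    let ?s = "set_reg 10 (N1 * N2) (set_reg 3 1 (set_reg 13 0 (matrix_input N1 N2 N3 A B)))"
    let ?columns = "For 3 5 2 (For 3 6 1 (Op Mul 8 6 2 ;; Op Add 8 8 5 ;; Load 9 1 8 ;;
      Op Add 9 9 3 ;; Store 3 7 9 ;; Op Add 7 7 3))"
    let ?rest = "Const 11 K ;; Op Mul 20 7 11 ;; Op Add 20 20 11 ;;
      While (Less 7 20) (Store 3 7 3 ;; Op Add 7 7 3) ;; relocate P ;; query_part"
    have 2: "runs w (?columns ;; ?rest) (N3 * (N2 * 8 + 2 + 2) + 2 +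
      (3 + t2)) s post"
      if "loading N1 N2 N3 A B (N1 * N2) s" for s
      by (rule runs_Seq_then[OF runs_load_columns[OF that small(5,6,2,3)] 3])
        (simp add: mult.commute)
    have "inner (matrix_input N1 N2 N3 A B) = loaded N1 N2 N3 A B 0"
      by (auto simp: inner_def matrix_input_def loaded_def fun_eq_iff)
    then have "loading N1 N2 N3 A B 0 (set_reg 7 0 ?s)"
      by (simp add: loading_def frame_def) (simp add: matrix_input_def)
    then have "runs w (For 3 7 10 (Load 9 0 7 ;; Store 3 7 9) ;; ?columns ;; ?rest)
      t1 ?s post"
      unfolding t1_def by (rule runs_Seq_then[OF runs_load_rows[OF _ small(4)] 2])
    moreover have "(1::nat) mod 2 ^ w = 1" using small(6) by (intro mod_less) linarith
    ultimately show ?thesis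
      using small by (simp add: multiply_by_queries_def query_part_def matrix_input_def)
  qed
  then show ?thesis
    unfolding post_def
  proof (rule runs_mono)
    \<comment> \<open>The overhead of 4 per row is charged to the entries, raising 11 to 15.\<close>
    have "N1 * 1 \<le> N1 * N3" using N by (intro mult_le_mono2) simp
    moreover have "13 + N1 * N2 * 4 + N3 * (N2 * 8 + 4) + 3 * L \<le> 30 * L"
    proof -
      have "13 + N1 * N2 * 4 + N3 * (N2 * 8 + 4) = 13 + 4 * (N1 * N2) + 8 * (N2 * N3) + 4 * N3"
        by (simp add: algebra_simps)
      then show ?thesis using N3 sum_L by linarith
    qed
    ultimately show "3 + t1 \<le>
      30 * L + tP + N1 * N3 * (tQ + 15)"
      by (simp only: t1_def t2_def tq_def add_mult_distrib add_mult_distrib2 mult.assoc)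
  qed
qed


section \<open>Dimensions, word sizes and running times\<close>

text \<open>A real number that is at least 1 is less than twice its floor, so rounding costs at most
  a factor 2.\<close>

lemma dimension_bounds:
  assumes "1 \<le> n" "0 \<le> a"
  shows "real (dimension n a) \<le> real n powr a" "real n powr a \<le> 2 * real (dimension n a)"
    "0 < dimension n a"
proof -
  have "1 \<le> real n powr a" using assms by (intro ge_one_powr_ge_zero) auto
  then have "1 \<le> \<lfloor>real n powr a\<rfloor>" by linarith
  then have "real (dimension n a) = of_int \<lfloor>real n powr a\<rfloor>" "0 < dimension n a"
    by (auto simp: dimension_def)
  with \<open>1 \<le> \<lfloor>real n powr a\<rfloor>\<close>
  show "real (dimension n a) \<le> real n powr a" "real n powr a \<le> 2 * real (dimension n a)"
    "0 < dimension n a" by linarith+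
qed

section \<open>Word sizes under a change of the size parameter\<close>

lemma log_shift_le:
  fixes m n :: nat and D :: real
  assumes "real n \<le> D * real m" "1 \<le> D"
  shows "log 2 (real n + 2) \<le> (1 + log 2 D) * log 2 (real m + 2)"
proof -
  have "real n + 2 \<le> D * (real m + 2)" using assms by (simp add: algebra_simps)
  then have "log 2 (real n + 2) \<le> log 2 (D * (real m + 2))" using assms by simp
  also have "\<dots> = log 2 D * 1 + log 2 (real m + 2)"
    using assms by (simp add: log_mult)
  \<comment> \<open>The shift by 2 makes the logarithm at least 1, which turns the additive
    \<open>log 2 D\<close> into a factor.\<close>
  also have "\<dots> \<le> log 2 D * log 2 (real m + 2) + log 2 (real m + 2)"
    using assms by (intro add_right_mono mult_left_mono) (auto simp: le_log_iff)
  finally show ?thesis by (simp add: algebra_simps)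
qed

lemma word_size_mono: "word_size \<kappa> \<kappa>' n w \<Longrightarrow> \<kappa>0 \<le> \<kappa> \<Longrightarrow> word_size \<kappa>0 \<kappa>' n w"
  unfolding word_size_def by (smt (verit) mult_right_mono zero_le_log_cancel_iff of_nat_0_le_iff)

text \<open>Matrices are measured by \<open>m\<close> and strings by \<open>n\<close>, but both
  share one word size. Comparable parameters have comparable logarithms, so only the constants
  change. \<open>max 0 \<kappa>'\<close> covers negative \<open>\<kappa>'\<close>, for which a
  larger factor would weaken nothing.\<close>

lemma word_size_transfer:
  assumes nm: "real n \<le> D * real m" "real m \<le> D * real n" and D: "1 \<le> D" and "0 < \<kappa>"
    and w: "word_size (\<kappa> * (1 + log 2 D)) \<kappa>' m w"
  shows "word_size \<kappa> (max 0 \<kappa>' * (1 + log 2 D)) n w"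
proof -
  have "\<kappa> * log 2 (real n + 2) \<le> \<kappa> * ((1 + log 2 D) * log 2 (real m + 2))"
    using log_shift_le[OF nm(1) D] \<open>0 < \<kappa>\<close> by simp
  moreover have "\<kappa>' * log 2 (real m + 2) \<le> max 0 \<kappa>' * log 2 (real m + 2)"
    by (intro mult_right_mono) auto
  moreover have "max 0 \<kappa>' * log 2 (real m + 2) \<le>
      max 0 \<kappa>' * ((1 + log 2 D) * log 2 (real n + 2))"
    using log_shift_le[OF nm(2) D] by (intro mult_left_mono) auto
  ultimately show ?thesis
    using w unfolding word_size_def mult.assoc by linarith
qed

text \<open>Makes room for \<open>L\<close>, which is linear in \<open>m\<close>, and for
  \<open>N1 * N3\<close>, which is at most quadratic.\<close>

lemma word_size_lower_bound:
  assumes "word_size (2 + log 2 D) \<kappa>' m w" "1 \<le> D"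
  shows "D * (real m + 2)\<^sup>2 \<le> 2 ^ w"
proof -
  have "log 2 (D * (real m + 2)\<^sup>2) = log 2 D * 1 + 2 * log 2 (real m + 2)"
    using assms by (simp add: log_mult log_nat_power)
  also have "\<dots> \<le> log 2 D * log 2 (real m + 2) + 2 * log 2 (real m + 2)"
    using assms by (intro add_right_mono mult_left_mono) (auto simp: le_log_iff)
  also have "\<dots> \<le> real w"
    using assms by (simp add: word_size_def algebra_simps)
  finally have "D * (real m + 2)\<^sup>2 \<le> 2 powr real w"
    using assms by (subst (asm) log_le_iff) auto
  then show ?thesis by (simp add: powr_realpow)
qed

text \<open>The three lower bounds on \<open>e\<close> are the exponents of writing the string,
  preprocessing and querying. \<open>\<alpha> + \<beta> = g\<close> limits the wildcards;
  \<open>\<beta> + \<gamma> = 1\<close> and \<open>g \<le> 1\<close> make the string linear in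
  \<open>m\<close>.\<close>

lemma exists_multiplies_in_time:
  fixes \<alpha> \<beta> \<gamma> g q e f c1 c2 c3 :: real
  assumes pos: "0 < \<alpha>" "0 < \<beta>" "0 < \<gamma>" "0 < q"
    and exps: "\<alpha> + \<beta> = g" "\<beta> + \<gamma> = 1" "g \<le> 1" "1 \<le> e" "f \<le> e" "\<alpha> + \<gamma> + q \<le> e"
    and \<sigma>: "2 \<le> \<sigma>" and c: "0 < c1" "c1 < c2" "0 < c3"
    and ds: "lcew_data_structure (input_class \<sigma> c1 c2 c3 g) q P Q"
    and pre: "preprocessing_time (input_class \<sigma> c1 c2 c3 g) f P"
  shows "\<exists>K. multiplies_in_time \<alpha> \<beta> \<gamma> e (multiply_by_queries K P Q)"
proof -
  obtain \<kappa>1 where \<kappa>1: "0 < \<kappa>1"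
    and ds': "\<And>\<kappa>'. \<exists>C. \<forall>n\<ge>1. \<forall>w. word_size \<kappa>1 \<kappa>' n w \<longrightarrow> (\<forall>T\<in>input_class \<sigma> c1 c2 c3 g n.
        \<forall>s i j. ds_state w P Q T s \<longrightarrow> query_position T i \<longrightarrow> query_position T j \<longrightarrow>
           (\<exists>t s'. exec w Q (query_input i j s) t s' \<and> real t \<le> C * real n powr q \<and>
                   reg s' 0 = lcew T i j))"
    using ds unfolding lcew_data_structure_def by metis
  obtain \<kappa>2 where \<kappa>2: "0 < \<kappa>2"
    and pre': "\<And>\<kappa>'. \<exists>C. \<forall>n\<ge>1. \<forall>w. word_size \<kappa>2 \<kappa>' n w \<longrightarrow> (\<forall>T\<in>input_class \<sigma> c1 c2 c3 g n.
        \<exists>t s. exec w P (string_input T) t s \<and> real t \<le> C * real n powr f)"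
    using pre unfolding preprocessing_time_def by metis
  have g: "0 < g" using pos exps by simp

  \<comment> \<open>\<open>K\<close> must be so large that \<open>[L / c2, L / c1]\<close> contains an integer \<open>n\<close> for every length
    \<open>L \<ge> K\<close>, and that this \<open>n\<close> satisfies \<open>m\<^sup>g \<le> c3 n\<^sup>g\<close> when \<open>n \<ge> K m / (4 c2)\<close>.\<close>
  obtain K :: nat where K: "1 / (1 / c1 - 1 / c2) \<le> K" "4 * c2 * (1 / c3) powr (1 / g) \<le> K" "1 \<le> K"
  proof
    let ?K = "nat \<lceil>1 / (1 / c1 - 1 / c2)\<rceil> + nat \<lceil>4 * c2 * (1 / c3) powr (1 / g)\<rceil> + 1"
    show "1 / (1 / c1 - 1 / c2) \<le> ?K" "4 * c2 * (1 / c3) powr (1 / g) \<le> ?K" "1 \<le> ?K"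
      by linarith+
  qed
  \<comment> \<open>\<open>D\<close> bounds \<open>n / m\<close> by \<open>3 * K / c1\<close> and
    \<open>m / n\<close> by \<open>4 * c2\<close>; the 1 keeps \<open>log 2 D\<close>
    nonnegative.\<close>
  define D where "D = max 1 (max (3 * real K / c1) (4 * c2))"
  define E where "E = 1 + log 2 D"
  have D: "1 \<le> D" "3 * real K / c1 \<le> D" "4 * c2 \<le> D" by (auto simp: D_def)
  have E: "1 \<le> E" using D by (simp add: E_def)
  \<comment> \<open>The summands meet the word-size demands of \<open>Q\<close>, of \<open>P\<close>
    and of arithmetic without overflow; \<open>E\<close> is the loss in passing between
    \<open>m\<close> and \<open>n\<close>.\<close>
  define \<kappa> where "\<kappa> = \<kappa>1 * E + \<kappa>2 * E + (2 + log 2 (3 * real K))"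
  have logK: "0 \<le> log 2 (3 * real K)" using K by simp
  have \<kappa>: "\<kappa>1 * E \<le> \<kappa>" "\<kappa>2 * E \<le> \<kappa>" "2 + log 2 (3 * real K) \<le> \<kappa>" "0 < \<kappa>"
    using \<kappa>1 \<kappa>2 E logK by (auto simp: \<kappa>_def add_nonneg_nonneg intro: add_nonneg_pos)

  have "\<exists>C. \<forall>m\<ge>1. \<forall>w. word_size \<kappa> \<kappa>' m w \<longrightarrow> (\<forall>A B.
        let N1 = dimension m \<alpha>; N2 = dimension m \<beta>; N3 = dimension m \<gamma> in
        \<exists>t s. exec w (multiply_by_queries K P Q) (matrix_input N1 N2 N3 A B) t s \<and>
              real t \<le> C * real m powr e \<and>
              (\<forall>i<N1. \<forall>j<N3. arr s 2 (i * N3 + j) = of_bool (bmm N2 A B i j)))" for \<kappa>'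
  proof -
    obtain C1 where C1: "\<And>n w T s i j. n \<ge> 1 \<Longrightarrow> word_size \<kappa>1 (max 0 \<kappa>' * E) n w \<Longrightarrow>
        T \<in> input_class \<sigma> c1 c2 c3 g n \<Longrightarrow> ds_state w P Q T s \<Longrightarrow> query_position T i \<Longrightarrow>
        query_position T j \<Longrightarrow> \<exists>t s'. exec w Q (query_input i j s) t s' \<and>
          real t \<le> C1 * real n powr q \<and> reg s' 0 = lcew T i j"
      using ds'[of "max 0 \<kappa>' * E"] by metis
    obtain C2 where C2: "\<And>n w T. n \<ge> 1 \<Longrightarrow> word_size \<kappa>2 (max 0 \<kappa>' * E) n w \<Longrightarrow>
        T \<in> input_class \<sigma> c1 c2 c3 g n \<Longrightarrow>
        \<exists>t s. exec w P (string_input T) t s \<and> real t \<le> C2 * real n powr f"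
      using pre'[of "max 0 \<kappa>' * E"] by metis
    \<comment> \<open>One summand each for writing, preprocessing and querying; the hidden constants
      may be negative, hence the absolute values.\<close>
    define C where "C = 90 * real K + \<bar>C2\<bar> * D powr e + (\<bar>C1\<bar> * D powr q + 15)"
    show ?thesis
      unfolding Let_def
    proof (intro exI[of _ C] allI impI)
      fix m w A B
      assume m: "1 \<le> m" and w: "word_size \<kappa> \<kappa>' m w"
      define N1 N2 N3 where N_def: "N1 = dimension m \<alpha>" "N2 = dimension m \<beta>" "N3 = dimension m \<gamma>"
      have N: "0 < N1" "0 < N2" "0 < N3"
          "real N1 \<le> real m powr \<alpha>" "real N2 \<le> real m powr \<beta>" "real N3 \<le> real m powr \<gamma>"
          "real m powr \<beta> \<le> 2 * real N2" "real m powr \<gamma> \<le> 2 * real N3"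
        using dimension_bounds m pos by (auto simp: N_def less_imp_le)
      have N12: "real N1 * real N2 \<le> real m powr g"
        using mult_mono[OF N(4,5)] by (simp add: powr_add[symmetric] exps)
      have N23: "real N2 * real N3 \<le> real m"
        using mult_mono[OF N(5,6)] m by (simp add: powr_add[symmetric] exps)
      have N13: "real N1 * real N3 \<le> real m powr (\<alpha> + \<gamma>)"
        using mult_mono[OF N(4,6)] by (simp add: powr_add)
      have m_le: "real m \<le> 4 * (real N2 * real N3)"
        using mult_mono[OF N(7,8)] m by (simp add: powr_add[symmetric] exps)
      have mg: "real m powr g \<le> real m"
        using powr_mono[of g 1 "real m"] exps m by simp
      have me: "real m \<le> real m powr e"
        using powr_mono[of 1 e "real m"] exps m by simp

      define L where "L = K * (N1 * N2 + N2 * N3 + 1)"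
      have L_eq: "real L = real K * (real N1 * real N2 + real N2 * real N3 + 1)"
        by (simp add: L_def algebra_simps)
      have L_le: "real L \<le> 3 * real K * real m"
      proof -
        have "real N1 * real N2 + real N2 * real N3 + 1 \<le> 3 * real m"
          using N12 N23 mg m by linarith
        from mult_left_mono[OF this, of "real K"] show ?thesis by (simp add: L_eq)
      qed
      have K_le_L: "real K \<le> real L" by (simp add: L_def)
      have L_pos: "0 < real L" using K_le_L K by linarith

      \<comment> \<open>The least \<open>n\<close> with \<open>L \<le> c2 * n\<close>. The choice of
        \<open>K\<close> makes the interval from \<open>L / c2\<close> to \<open>L / c1\<close> at
        least 1 long, so also \<open>c1 * n \<le> L\<close>.\<close>
      define n where "n = nat \<lceil>real L / c2\<rceil>"
      have n_ge: "real L / c2 \<le> real n" by (simp add: n_def real_nat_ceiling_ge)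
      have n_le: "real n \<le> real L / c1"
      proof -
        have d: "0 < 1 / c1 - 1 / c2" using c by (simp add: field_simps)
        then have "1 \<le> real K * (1 / c1 - 1 / c2)" using K(1) by (simp add: pos_divide_le_eq)
        also have "\<dots> \<le> real L * (1 / c1 - 1 / c2)"
          using d K_le_L by (intro mult_right_mono) auto
        finally have "real L / c2 + 1 \<le> real L / c1" by (simp add: algebra_simps)
        moreover have "0 \<le> real L / c2" using c by simp
        ultimately show ?thesis unfolding n_def by linarith
      qed
      have "0 < real L / c2" using c L_pos by simp
      then have n1: "1 \<le> n" using n_ge by linarith

      have nm: "real n \<le> D * real m"
      proof -
        have "real L / c1 \<le> 3 * real K * real m / c1"
          using L_le c by (intro divide_right_mono) auto
        also have "\<dots> = (3 * real K / c1) * real m" by simp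
        also have "\<dots> \<le> D * real m" using D by (intro mult_right_mono) auto
        finally show ?thesis using n_le by linarith
      qed
      \<comment> \<open>Padding enlarges \<open>n\<close> in proportion to \<open>K\<close> and
        leaves the wildcards alone; this pays for a small \<open>c3\<close>.\<close>
      have Km: "real K / (4 * c2) * real m \<le> real n"
      proof -
        have "real K * real m \<le> real K * (4 * (real N2 * real N3))"
          using m_le by (intro mult_left_mono) auto
        also have "\<dots> \<le> 4 * real L"
          by (simp add: L_eq algebra_simps)
        finally have "real K / (4 * c2) * real m \<le> real L / c2"
          using c by (simp add: field_simps)
        then show ?thesis using n_ge by linarith
      qed
      have mn: "real m \<le> D * real n"
      proof -
        have "1 / (4 * c2) * real m \<le> real K / (4 * c2) * real m"
          using K c by (intro mult_right_mono divide_right_mono) auto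
        then have "real m \<le> 4 * c2 * real n" using Km c by (simp add: field_simps)
        also have "\<dots> \<le> D * real n" using D by (intro mult_right_mono) auto
        finally show ?thesis .
      qed

      define T where "T = matrix_string L N1 N2 N3 A B"
      have T: "T \<in> input_class \<sigma> c1 c2 c3 g n"
      proof -
        have "real (wildcards T) \<le> real (N1 * N2)"
          unfolding T_def of_nat_le_iff by (rule wildcards_matrix_string)
        also have "\<dots> \<le> 1 * real m powr g" using N12 by simp
        also have "\<dots> \<le> (c3 * (real K / (4 * c2)) powr g) * real m powr g"
        proof (intro mult_right_mono)
          have "(1 / c3) powr (1 / g) \<le> real K / (4 * c2)"
            using K(2) c by (simp add: field_simps)
          then have "((1 / c3) powr (1 / g)) powr g \<le> (real K / (4 * c2)) powr g"
            using g by (intro powr_mono2) auto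
          then have "1 / c3 \<le> (real K / (4 * c2)) powr g"
            using g c by (simp add: powr_powr)
          then show "1 \<le> c3 * (real K / (4 * c2)) powr g"
            using c by (simp add: field_simps)
        qed simp
        also have "\<dots> = c3 * (real K / (4 * c2) * real m) powr g"
          using c by (simp only: powr_mult mult.assoc)
        also have "\<dots> \<le> c3 * real n powr g"
          using Km c g by (intro mult_left_mono powr_mono2) auto
        finally have "real (wildcards T) \<le> c3 * real n powr g" .
        moreover have "c1 * real n \<le> real L" "real L \<le> c2 * real n"
          using n_le n_ge c by (simp_all add: field_simps)
        ultimately show ?thesis
          using set_matrix_string[OF \<sigma>] by (simp add: input_class_def T_def)
      qed

      have w1: "word_size \<kappa>1 (max 0 \<kappa>' * E) n w"
        unfolding E_def by (rule word_size_transfer[OF nm mn D(1) \<kappa>1])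
          (rule word_size_mono[OF w \<kappa>(1)[unfolded E_def]])
      have w2: "word_size \<kappa>2 (max 0 \<kappa>' * E) n w"
        unfolding E_def by (rule word_size_transfer[OF nm mn D(1) \<kappa>2])
          (rule word_size_mono[OF w \<kappa>(2)[unfolded E_def]])
      have w3: "3 * real K * (real m + 2)\<^sup>2 \<le> 2 ^ w"
        using K by (intro word_size_lower_bound[OF word_size_mono[OF w \<kappa>(3)]]) simp
      have small: "L < 2 ^ w" "N1 * N3 < 2 ^ w"
      proof -
        have m2: "real m < (real m + 2)\<^sup>2" "real m * real m < (real m + 2)\<^sup>2"
          by (auto simp: power2_eq_square algebra_simps intro: add_pos_nonneg)
        have "real L < 3 * real K * (real m + 2)\<^sup>2"
          by (rule le_less_trans[OF L_le mult_strict_left_mono[OF m2(1)]]) (use K in simp)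
        then have "real L < 2 ^ w" using w3 by linarith
        then show "L < 2 ^ w" by simp
        have "real N1 \<le> real m" "real N3 \<le> real m"
          using N(4,6) powr_mono[of \<alpha> 1 "real m"] powr_mono[of \<gamma> 1 "real m"] m exps pos by auto
        then have "real N1 * real N3 \<le> real m * real m" by (intro mult_mono) auto
        also have "\<dots> < 1 * (real m + 2)\<^sup>2" using m2 by simp
        also have "\<dots> \<le> 3 * real K * (real m + 2)\<^sup>2"
          using K by (intro mult_right_mono) auto
        finally have "real (N1 * N3) < 2 ^ w" using w3 by simp
        then show "N1 * N3 < 2 ^ w" by (metis of_nat_less_numeral_power_cancel_iff)
      qed

      obtain tP sP where tP: "exec w P (string_input T) tP sP" "real tP \<le> C2 * real n powr f"
        using C2[OF n1 w2 T] by blast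
      define tQ where "tQ = nat \<lfloor>\<bar>C1\<bar> * real n powr q\<rfloor>"
      have query: "runs w Q tQ (query_input i j s) (\<lambda>s'. reg s' 0 = lcew T i j)"
        if "ds_state w P Q T s" "query_position T i" "query_position T j" for s i j
      proof -
        from C1[OF n1 w1 T that] obtain t s' where t: "exec w Q (query_input i j s) t s'"
          "real t \<le> C1 * real n powr q" "reg s' 0 = lcew T i j" by blast
        have "C1 * real n powr q \<le> \<bar>C1\<bar> * real n powr q" by (intro mult_right_mono) auto
        then have "t \<le> tQ" using t(2) unfolding tQ_def by (intro le_nat_floor) linarith
        then show ?thesis using t by (auto intro: runsI)
      qed
      have "runs w (multiply_by_queries K P Q) (30 * L + tP + N1 * N3 * (tQ + 15))
        (matrix_input N1 N2 N3 A B)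
        (\<lambda>s. \<forall>i<N1. \<forall>j<N3. arr s 2 (i * N3 + j) = of_bool (bmm N2 A B i j))"
        unfolding L_def
        by (rule runs_multiply_by_queries[where P = P and tQ = tQ])
          (use N K small query tP in \<open>auto simp: L_def T_def intro: runsI\<close>)
      then obtain t s where t: "exec w (multiply_by_queries K P Q) (matrix_input N1 N2 N3 A B) t s"
        "t \<le> 30 * L + tP + N1 * N3 * (tQ + 15)"
        "\<forall>i<N1. \<forall>j<N3. arr s 2 (i * N3 + j) = of_bool (bmm N2 A B i j)"
        by (auto simp: runs_def)

      have Dm: "real n powr x \<le> D powr x * real m powr x" if "0 \<le> x" for x
      proof -
        have "real n powr x \<le> (D * real m) powr x" using nm that by (intro powr_mono2) auto
        then show ?thesis using D by (simp add: powr_mult)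
      qed
      have "30 * real L \<le> 90 * real K * real m powr e"
      proof -
        have "3 * real K * real m \<le> 3 * real K * real m powr e"
          using me by (intro mult_left_mono) auto
        then show ?thesis using L_le by linarith
      qed
      moreover have "real tP \<le> \<bar>C2\<bar> * D powr e * real m powr e"
      proof -
        have "real tP \<le> \<bar>C2\<bar> * real n powr f"
          by (rule order_trans[OF tP(2)]) (intro mult_right_mono, auto)
        \<comment> \<open>\<open>f\<close> may be negative, so it is raised to \<open>e\<close>
          while the base is still \<open>n\<close>; \<open>Dm\<close> needs a nonnegative
          exponent.\<close>
        also have "\<dots> \<le> \<bar>C2\<bar> * real n powr e"
          using n1 exps by (intro mult_left_mono powr_mono) auto
        also have "\<dots> \<le> \<bar>C2\<bar> * (D powr e * real m powr e)"
          using Dm[of e] exps by (intro mult_left_mono) auto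
        finally show ?thesis by (simp add: mult.assoc)
      qed
      moreover have "real N1 * real N3 * (real tQ + 15) \<le> (\<bar>C1\<bar> * D powr q + 15) * real m powr e"
      proof -
        have "real tQ \<le> \<bar>C1\<bar> * real n powr q" unfolding tQ_def by simp
        also have "\<dots> \<le> \<bar>C1\<bar> * (D powr q * real m powr q)"
          using Dm[of q] pos by (intro mult_left_mono) auto
        moreover have "1 \<le> real m powr q" using m pos by (intro ge_one_powr_ge_zero) auto
        ultimately have "real tQ + 15 \<le> (\<bar>C1\<bar> * D powr q + 15) * real m powr q"
          by (simp add: algebra_simps)
        then have "real N1 * real N3 * (real tQ + 15) \<le>
            real m powr (\<alpha> + \<gamma>) * ((\<bar>C1\<bar> * D powr q + 15) * real m powr q)"
          using N13 by (intro mult_mono) auto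
        also have "\<dots> = (\<bar>C1\<bar> * D powr q + 15) * real m powr (\<alpha> + \<gamma> + q)"
          by (simp add: powr_add)
        also have "\<dots> \<le> (\<bar>C1\<bar> * D powr q + 15) * real m powr e"
          using m exps by (intro mult_left_mono powr_mono) auto
        finally show ?thesis .
      qed
      moreover have "real t \<le> 30 * real L + real tP + real N1 * real N3 * (real tQ + 15)"
        using of_nat_mono[OF t(2), where 'a = real] by simp
      ultimately have "real t \<le> C * real m powr e"
        by (simp add: C_def algebra_simps)
      then show "\<exists>t s. exec w (multiply_by_queries K P Q)
          (matrix_input (dimension m \<alpha>) (dimension m \<beta>) (dimension m \<gamma>) A B) t s \<and>
        real t \<le> C * real m powr e \<and>
        (\<forall>i<dimension m \<alpha>. \<forall>j<dimension m \<gamma>. arr s 2 (i * dimension m \<gamma> + j) =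
          of_bool (bmm (dimension m \<beta>) A B i j))"
        using t unfolding N_def by blast
    qed
  qed
  then show ?thesis
    unfolding multiplies_in_time_def using \<kappa>(4) by blast
qed

theorem theorem8:
  fixes \<epsilon> q g c1 c2 c3 :: real
    and \<sigma> :: nat
    and combinatorial :: "artefact \<Rightarrow> bool"
    and P Q :: program
  assumes "0 < \<epsilon>" and "0 < q" and "q < g" and "g < 1"
    and "2 \<le> \<sigma>" and "0 < c1" and "c1 < c2" and "0 < c3"
    and "closed_under_querying combinatorial"
    and "combinatorial_mm_conjecture combinatorial"
    and "combinatorial (Data_Structure P Q)"
    and "lcew_data_structure (input_class \<sigma> c1 c2 c3 g) q P Q"
  shows "\<not> preprocessing_time (input_class \<sigma> c1 c2 c3 g) (1 + g - q - \<epsilon>) P"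
proof
  define \<delta> where "\<delta> = min (\<epsilon> / 2) ((g - q) / 2)"
  have \<delta>: "0 < \<delta>" "2 * \<delta> \<le> \<epsilon>" "2 * \<delta> \<le> g - q"
    using assms(1,3) by (auto simp: \<delta>_def min_def)
  define \<alpha> \<beta> \<gamma> where exps: "\<alpha> = g - q - \<delta>" "\<beta> = q + \<delta>" "\<gamma> = 1 - q - \<delta>"
  \<comment> \<open>\<open>q + \<delta>\<close> is at most the midpoint of \<open>q\<close> and
    \<open>g\<close>, hence below both \<open>g\<close> and 1.\<close>
  have pos: "0 < \<alpha>" "0 < \<beta>" "0 < \<gamma>"
    using \<delta> assms(2-4) by (auto simp: exps)
  assume "preprocessing_time (input_class \<sigma> c1 c2 c3 g) (1 + g - q - \<epsilon>) P"
  \<comment> \<open>The exponent equals \<open>\<alpha> + \<gamma> + q\<close>, so the total query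
    time meets it exactly.\<close>
  then have "\<exists>K. multiplies_in_time \<alpha> \<beta> \<gamma> (\<alpha> + \<beta> + \<gamma> - \<delta>) (multiply_by_queries K P Q)"
    by (intro exists_multiplies_in_time[OF pos assms(2) _ _ _ _ _ _ assms(5-8,12)])
      (use \<delta> assms(4) in \<open>auto simp: exps\<close>)
  then show False
    using assms(9-11) pos \<delta>(1)
    unfolding closed_under_querying_def combinatorial_mm_conjecture_def by blast
qed

end
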